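(* Suppose $(\mathsf P,\mathsf{Opens})$ is a semitopology and $p\in \mathsf P$. Then the following are equivalent: \begin{enumerate} \item $p$ is regular, or in full: $p\in K(p)\in\mathsf{Topen}$. \item $K(p)$ is the greatest topen neighbourhood of $p$. \item $K(p)$ is a maximal topen neighbourhood of $p$. \item $p$ has a maximal topen neighbourhood. \item $p$ has some topen neighbourhood. \end{enumerate}
   Context: A semitopology is a pair $(\mathsf P,\mathsf{Opens})$ with $\mathsf{Opens}\subseteq\mathcal P(\mathsf P)$ containing $\varnothing$ and $\mathsf P$ and closed under arbitrary unions; elements of $\mathsf{Opens}$ are open sets, and an open neighbourhood of $p$ is an open set containing $p$. For sets $X,Y$ write $X\between Y$ when $X\cap Y\neq\varnothing$. A set $T\subseteq\mathsf P$ is transitive when for all $O,O'\in\mathsf{Opens}$, $O\between T$ and $T\between O'$ imply $O\between O'$; $T$ is topen when it is nonempty, open and transitive, and $\mathsf{Topen}$ denotes the set of topens. Points $p,p'$ are intertwined when every open neighbourhood of $p$ intersects every open neighbourhood of $p'$; write $p_{\between}=\{p'\in\mathsf P\mid p,p'\text{ intertwined}\}$ for the set of points intertwined with $p$. The interior $\mathrm{interior}(X)$ is the union of all open sets contained in $X$. The community of $p$ is $K(p)=\mathrm{interior}(p_{\between})$, and $p$ is regular when $p\in K(p)\in\mathsf{Topen}$. *)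

theory Defs
  imports Main
begin

definition semitopology :: "'a set \<Rightarrow> 'a set set \<Rightarrow> bool" where
  "semitopology P Opens \<longleftrightarrow>
     Opens \<subseteq> Pow P \<and> {} \<in> Opens \<and> P \<in> Opens \<and> (\<forall>\<O>. \<O> \<subseteq> Opens \<longrightarrow> \<Union>\<O> \<in> Opens)"

definition between :: "'a set \<Rightarrow> 'a set \<Rightarrow> bool" (infix "\<between>" 50) where
  "X \<between> Y \<longleftrightarrow> X \<inter> Y \<noteq> {}"

definition transitive_set :: "'a set \<Rightarrow> 'a set set \<Rightarrow> 'a set \<Rightarrow> bool" where
  "transitive_set P Opens T \<longleftrightarrow>
     T \<subseteq> P \<and> (\<forall>O1\<in>Opens. \<forall>O2\<in>Opens. O1 \<between> T \<longrightarrow> T \<between> O2 \<longrightarrow> O1 \<between> O2)"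

definition Topen :: "'a set \<Rightarrow> 'a set set \<Rightarrow> 'a set set" where
  "Topen P Opens = {T. T \<noteq> {} \<and> T \<in> Opens \<and> transitive_set P Opens T}"

definition intertwined :: "'a set set \<Rightarrow> 'a \<Rightarrow> 'a \<Rightarrow> bool" where
  "intertwined Opens p p' \<longleftrightarrow>
     (\<forall>O1\<in>Opens. \<forall>O2\<in>Opens. p \<in> O1 \<longrightarrow> p' \<in> O2 \<longrightarrow> O1 \<between> O2)"

definition intertwined_set :: "'a set \<Rightarrow> 'a set set \<Rightarrow> 'a \<Rightarrow> 'a set" where
  "intertwined_set P Opens p = {p' \<in> P. intertwined Opens p p'}"

definition semi_interior :: "'a set set \<Rightarrow> 'a set \<Rightarrow> 'a set" where
  "semi_interior Opens X = \<Union>{U \<in> Opens. U \<subseteq> X}"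

definition community :: "'a set \<Rightarrow> 'a set set \<Rightarrow> 'a \<Rightarrow> 'a set" where
  "community P Opens p = semi_interior Opens (intertwined_set P Opens p)"

definition regular_point :: "'a set \<Rightarrow> 'a set set \<Rightarrow> 'a \<Rightarrow> bool" where
  "regular_point P Opens p \<longleftrightarrow> p \<in> community P Opens p \<and> community P Opens p \<in> Topen P Opens"

definition topen_nbhd :: "'a set \<Rightarrow> 'a set set \<Rightarrow> 'a \<Rightarrow> 'a set \<Rightarrow> bool" where
  "topen_nbhd P Opens p T \<longleftrightarrow> T \<in> Topen P Opens \<and> p \<in> T"

definition greatest_topen_nbhd :: "'a set \<Rightarrow> 'a set set \<Rightarrow> 'a \<Rightarrow> 'a set \<Rightarrow> bool" where
  "greatest_topen_nbhd P Opens p T \<longleftrightarrow>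
     topen_nbhd P Opens p T \<and> (\<forall>T'. topen_nbhd P Opens p T' \<longrightarrow> T' \<subseteq> T)"

(* Any topen containing a neighbourhood of p is itself a neighbourhood of p, so being maximal
   among the topen neighbourhoods of p is the same as being a maximal topen that contains p. *)
definition maximal_topen_nbhd :: "'a set \<Rightarrow> 'a set set \<Rightarrow> 'a \<Rightarrow> 'a set \<Rightarrow> bool" where
  "maximal_topen_nbhd P Opens p T \<longleftrightarrow>
     topen_nbhd P Opens p T \<and> \<not> (\<exists>T'. topen_nbhd P Opens p T' \<and> T \<subset> T')"

end

theory Submission
  imports Defs
begin

text \<open>
  A topen neighbourhood \<open>T\<close> of \<open>p\<close> consists of points intertwined with \<open>p\<close>, so \<open>T \<subseteq> K(p)\<close>.
  Conversely, an open set that meets \<open>K(p)\<close> contains a point intertwined with \<open>p\<close> and hence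
  meets the open neighbourhood \<open>T\<close> of \<open>p\<close>; thus \<open>K(p)\<close> inherits transitivity from \<open>T\<close>. So as soon
  as one topen neighbourhood of \<open>p\<close> exists, \<open>K(p)\<close> is the greatest one.
\<close>

lemma open_community:
  assumes "semitopology P Opens"
  shows "community P Opens p \<in> Opens"
proof -
  have "{U \<in> Opens. U \<subseteq> intertwined_set P Opens p} \<subseteq> Opens"
    by blast
  then show ?thesis
    using assms unfolding semitopology_def community_def semi_interior_def by simp
qed

lemma community_subset_intertwined_set:
  "community P Opens p \<subseteq> intertwined_set P Opens p"
  unfolding community_def semi_interior_def by blast

text \<open>Open neighbourhoods of \<open>p\<close> and of a point \<open>q\<close> of
  \<open>T\<close> meet \<open>T\<close> at \<open>p\<close> and at \<open>q\<close>, so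
  transitivity of \<open>T\<close> makes them meet each other. Openness of \<open>T\<close> then
  places it inside the interior.\<close>

lemma topen_nbhd_subset_community:
  assumes "topen_nbhd P Opens p T"
  shows "T \<subseteq> community P Opens p"
proof -
  have T: "T \<in> Opens" "T \<subseteq> P" "p \<in> T"
    and trans: "\<And>O1 O2. \<lbrakk>O1 \<in> Opens; O2 \<in> Opens; O1 \<between> T; T \<between> O2\<rbrakk> \<Longrightarrow> O1 \<between> O2"
    using assms unfolding topen_nbhd_def Topen_def transitive_set_def by auto
  have "intertwined Opens p q" if "q \<in> T" for q
    unfolding intertwined_def
  proof (intro ballI impI)
    fix O1 O2
    assume "O1 \<in> Opens" "O2 \<in> Opens" "p \<in> O1" "q \<in> O2"
    moreover from this T \<open>q \<in> T\<close> have "O1 \<between> T" "T \<between> O2"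
      unfolding between_def by blast+
    ultimately show "O1 \<between> O2"
      using trans by blast
  qed
  with T have "T \<subseteq> intertwined_set P Opens p"
    unfolding intertwined_set_def by blast
  with T show ?thesis
    unfolding community_def semi_interior_def by blast
qed

text \<open>A point of \<open>U\<close> in the community is intertwined with \<open>p\<close>, and
  \<open>U\<close> and \<open>V\<close> are open neighbourhoods of the two. With a topen
  neighbourhood of \<open>p\<close> as \<open>V\<close>, this moves an intersection from the
  community to that topen.\<close>

lemma open_meets_nbhd_if_meets_community:
  assumes "U \<in> Opens" "V \<in> Opens" "p \<in> V" "U \<between> community P Opens p"
  shows "V \<between> U"
proof -
  obtain q where "q \<in> U" "q \<in> intertwined_set P Opens p"
    using assms(4) community_subset_intertwined_set[of P Opens p] unfolding between_def by blast
  then show ?thesis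
    using assms unfolding intertwined_set_def intertwined_def by blast
qed

lemma topen_nbhd_community:
  assumes "semitopology P Opens" "topen_nbhd P Opens p T"
  shows "topen_nbhd P Opens p (community P Opens p)"
proof -
  let ?K = "community P Opens p"
  have T: "T \<in> Opens" "p \<in> T"
    and trans: "\<And>O1 O2. \<lbrakk>O1 \<in> Opens; O2 \<in> Opens; O1 \<between> T; T \<between> O2\<rbrakk> \<Longrightarrow> O1 \<between> O2"
    using assms(2) unfolding topen_nbhd_def Topen_def transitive_set_def by auto
  have p: "p \<in> ?K"
    using topen_nbhd_subset_community[OF assms(2)] T by blast
  have K: "?K \<in> Opens" "?K \<subseteq> P"
    using open_community[OF assms(1)] community_subset_intertwined_set[of P Opens p]
    unfolding intertwined_set_def by auto
  have "O1 \<between> O2" if "O1 \<in> Opens" "O2 \<in> Opens" "O1 \<between> ?K" "?K \<between> O2" for O1 O2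
  \<comment> \<open>\<open>trans\<close> is the transitivity of \<open>T\<close>, so it remains to
    move both intersections from \<open>?K\<close> to \<open>T\<close>.\<close>
  proof (rule trans)
    have "T \<between> O1"
      using open_meets_nbhd_if_meets_community[OF that(1) T that(3)] .
    then show "O1 \<between> T"
      by (simp add: between_def Int_commute)
    have "O2 \<between> ?K"
      using that by (simp add: between_def Int_commute)
    then show "T \<between> O2"
      using open_meets_nbhd_if_meets_community[OF that(2) T] by blast
  qed (use that in auto)
  with K p show ?thesis
    unfolding topen_nbhd_def Topen_def transitive_set_def by blast
qed

lemma greatest_topen_nbhd_community:
  assumes "semitopology P Opens" "topen_nbhd P Opens p T"
  shows "greatest_topen_nbhd P Opens p (community P Opens p)"
  unfolding greatest_topen_nbhd_def
  by (intro conjI allI impI topen_nbhd_community[OF assms] topen_nbhd_subset_community)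

theorem theorem4p17:
  fixes P :: "'a set" and Opens :: "'a set set" and p :: 'a
  assumes "semitopology P Opens" and "p \<in> P"
  shows "(regular_point P Opens p \<longleftrightarrow> greatest_topen_nbhd P Opens p (community P Opens p)) \<and>
         (greatest_topen_nbhd P Opens p (community P Opens p) \<longleftrightarrow>
            maximal_topen_nbhd P Opens p (community P Opens p)) \<and>
         (maximal_topen_nbhd P Opens p (community P Opens p) \<longleftrightarrow>
            (\<exists>T. maximal_topen_nbhd P Opens p T)) \<and>
         ((\<exists>T. maximal_topen_nbhd P Opens p T) \<longleftrightarrow> (\<exists>T. topen_nbhd P Opens p T))"
proof -
  let ?K = "community P Opens p"
  have "regular_point P Opens p \<longleftrightarrow> topen_nbhd P Opens p ?K"
    unfolding regular_point_def topen_nbhd_def by blast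
  moreover have "greatest_topen_nbhd P Opens p ?K \<Longrightarrow> maximal_topen_nbhd P Opens p ?K"
    unfolding greatest_topen_nbhd_def maximal_topen_nbhd_def by blast
  moreover have "topen_nbhd P Opens p T" if "maximal_topen_nbhd P Opens p T" for T
    using that unfolding maximal_topen_nbhd_def by blast
  moreover have "greatest_topen_nbhd P Opens p ?K" if "topen_nbhd P Opens p T" for T
    using greatest_topen_nbhd_community[OF assms(1) that] .
  moreover have "greatest_topen_nbhd P Opens p ?K \<Longrightarrow> topen_nbhd P Opens p ?K"
    unfolding greatest_topen_nbhd_def by blast
  \<comment> \<open>Each of the five conditions yields some topen neighbourhood of \<open>p\<close>;
    any such neighbourhood makes \<open>?K\<close> the greatest one, and from this the other
    conditions follow.\<close>
  ultimately show ?thesis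
    by metis
qed

end
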